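(* Let $(\mathbb{S},\oplus,\odot,\mathbf{0},\mathbf{1})$ be a commutative semiring, let $d\ge1$, let $z=(z_1,z_2,\ldots)$ be an $\mathbb{S}^d$-valued time series that is eventually equal to $\mathbf 0^d$, and let $0\le s\le t\le+\infty$. Then for all $w,v\in\mathbb S\langle A\rangle$ $$\big\langle \mathrm{ISS}^{\mathbb S}_{s,t}(z),w\big\rangle\odot\big\langle \mathrm{ISS}^{\mathbb S}_{s,t}(z),v\big\rangle=\big\langle \mathrm{ISS}^{\mathbb S}_{s,t}(z),w\star v\big\rangle,$$ where $\star$ is the quasi-shuffle product on $\mathbb S\langle A\rangle$.
   Context: A commutative semiring $(\mathbb S,\oplus,\odot,\mathbf 0,\mathbf 1)$ consists of two commutative monoids $(\mathbb S,\oplus,\mathbf 0)$ and $(\mathbb S,\odot,\mathbf 1)$ such that $\odot$ distributes over $\oplus$ and $\mathbf 0\odot s=\mathbf 0$ for all $s$. The alphabet $A$ is the set of all non-constant formal commutative monomials $[a_1\cdots a_m]$ ($m\ge1$, $a_i\in\{1,\dots,d\}$). It is a commutative semigroup under multiplication of monomials, denoted $[a\ b]$ for $a,b\in A$. $A^*$ is the free monoid of words over $A$, with empty word $\mathbf e$. $\mathbb S\langle A\rangle$ is the free $\mathbb S$-semimodule on $A^*$ (finitely supported formal sums $\sum_w c_w w$, $c_w\in\mathbb S$). Any map $F:A^*\to\mathbb S$ is extended $\mathbb S$-linearly to $\mathbb S\langle A\rangle$; its value is written $\langle F,w\rangle$. The quasi-shuffle product $\star$ on $\mathbb S\langle A\rangle$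 is the bilinear product determined on words by $u\star\mathbf e=\mathbf e\star u=u$ and, for $u,v\in A^*$ and $a,b\in A$, $$ua\star vb=(u\star vb)a+(ua\star v)b+(u\star v)[a\ b].$$ For $z_j=(z_j^{(1)},\dots,z_j^{(d)})\in\mathbb S^d$ and a letter $a=[a_1\cdots a_m]\in A$ put $z_j^{\odot a}:=z_j^{(a_1)}\odot\cdots\odot z_j^{(a_m)}$. For $0\le s\le t\le+\infty$ the iterated-sums signature $\mathrm{ISS}^{\mathbb S}_{s,t}(z)$ is defined, for a word $w=w_1\cdots w_k$ with $w_i\in A$, by $$\langle \mathrm{ISS}^{\mathbb S}_{s,t}(z),w\rangle:=\bigoplus_{s<j_1<\cdots<j_k<t+1} z_{j_1}^{\odot w_1}\odot\cdots\odot z_{j_k}^{\odot w_k},$$ with value $\mathbf 1$ on the empty word; an empty sum is $\mathbf 0$. If $t=+\infty$, only finitely many summands differ from $\mathbf 0$, since $z$ is eventually $\mathbf 0^d$, and the sum is the sum of these. *)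

theory Defs
  imports "HOL-Analysis.Finite_Cartesian_Product"
    "HOL-Library.Multiset" "HOL-Library.Poly_Mapping" "HOL-Library.Extended_Nat"
begin

text \<open>
  A commutative semiring is a type of sort \<open>{comm_semiring_0, comm_monoid_mult}\<close>. The class
  \<open>comm_semiring_1\<close> would in addition demand \<open>0 \<noteq> 1\<close>.

  The index set \<open>{1, \<dots>, d}\<close> is a finite type \<open>'d\<close>. A non-constant commutative monomial
  in \<open>d\<close> variables is a nonempty multiset over \<open>'d\<close>, and the product of monomials is multiset union.
\<close>

typedef 'd letter = "{M :: 'd multiset. M \<noteq> {#}}"
  morphisms mset_of_letter Letter
  by (rule exI[of _ "{#undefined#}"]) simp

setup_lifting type_definition_letter

instantiation letter :: (type) ab_semigroup_mult
begin

lift_definition times_letter :: "'a letter \<Rightarrow> 'a letter \<Rightarrow> 'a letter" is "(+)"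
  by simp

instance
  by standard (transfer; simp add: ac_simps)+

end

text \<open>
  The free semimodule over \<open>'s\<close> on the words over \<open>'a\<close> is the type
  \<open>'a list \<Rightarrow>\<^sub>0 's\<close> of finitely supported functions.
\<close>

definition scale :: "'s::semiring_0 \<Rightarrow> ('w \<Rightarrow>\<^sub>0 's) \<Rightarrow> ('w \<Rightarrow>\<^sub>0 's)" where
  "scale c p = Poly_Mapping.map ((*) c) p"

definition lin_ext :: "('w \<Rightarrow> 's::semiring_0) \<Rightarrow> ('w \<Rightarrow>\<^sub>0 's) \<Rightarrow> 's" where
  "lin_ext F p = (\<Sum>w\<in>Poly_Mapping.keys p. Poly_Mapping.lookup p w * F w)"

definition append_letter ::
    "('a list \<Rightarrow>\<^sub>0 's::comm_monoid_add) \<Rightarrow> 'a \<Rightarrow> ('a list \<Rightarrow>\<^sub>0 's)" where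
  "append_letter p a =
     (\<Sum>w\<in>Poly_Mapping.keys p. Poly_Mapping.single (w @ [a]) (Poly_Mapping.lookup p w))"

function quasi_shuffle_words ::
    "'a::ab_semigroup_mult list \<Rightarrow> 'a list
      \<Rightarrow> ('a list \<Rightarrow>\<^sub>0 's::{comm_semiring_0, comm_monoid_mult})" where
  "quasi_shuffle_words u [] = Poly_Mapping.single u 1"
| "quasi_shuffle_words [] v = Poly_Mapping.single v 1"
| "quasi_shuffle_words (u @ [a]) (v @ [b]) =
     append_letter (quasi_shuffle_words u (v @ [b])) a
     + append_letter (quasi_shuffle_words (u @ [a]) v) b
     + append_letter (quasi_shuffle_words u v) (a * b)"
proof -
  fix P :: bool and x :: "'a list \<times> 'a list"
  assume 1: "\<And>u. x = (u, []) \<Longrightarrow> P" and 2: "\<And>v. x = ([], v) \<Longrightarrow> P"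
    and 3: "\<And>u a v b. x = (u @ [a], v @ [b]) \<Longrightarrow> P"
  obtain u v where x: "x = (u, v)" by (cases x)
  show P
    by (cases u rule: rev_cases; cases v rule: rev_cases) (use x 1 2 3 in auto)
qed auto
termination
  by (relation "measure (\<lambda>(u, v). length u + length v)") auto

definition quasi_shuffle ::
    "('a::ab_semigroup_mult list \<Rightarrow>\<^sub>0 's::{comm_semiring_0, comm_monoid_mult})
      \<Rightarrow> ('a list \<Rightarrow>\<^sub>0 's) \<Rightarrow> ('a list \<Rightarrow>\<^sub>0 's)"  (infixl "\<star>" 70) where
  "p \<star> q = (\<Sum>u\<in>Poly_Mapping.keys p. \<Sum>v\<in>Poly_Mapping.keys q.
      scale (Poly_Mapping.lookup p u * Poly_Mapping.lookup q v) (quasi_shuffle_words u v))"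

definition letter_power :: "'s::comm_monoid_mult ^ 'd \<Rightarrow> 'd letter \<Rightarrow> 's" where
  "letter_power x a = (\<Prod>i\<in>#mset_of_letter a. x $ i)"

text \<open>
  An increasing index tuple \<open>j\<^sub>1 < \<dots> < j\<^sub>k\<close> is a strictly increasing list. A time series is a
  function on \<open>nat\<close> whose value at \<open>0\<close> is never used, since all indices exceed \<open>s \<ge> 0\<close>.
\<close>

definition ISS_indices :: "enat \<Rightarrow> enat \<Rightarrow> nat \<Rightarrow> nat list set" where
  "ISS_indices s t k =
     {js. length js = k \<and> sorted_wrt (<) js \<and> (\<forall>j\<in>set js. s < enat j \<and> enat j < t + 1)}"

definition ISS_term :: "(nat \<Rightarrow> 's::comm_monoid_mult ^ 'd) \<Rightarrow> 'd letter list \<Rightarrow> nat list \<Rightarrow> 's" where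
  "ISS_term z w js = (\<Prod>i<length w. letter_power (z (js ! i)) (w ! i))"

text \<open>
  Restricting the sum to its nonzero summands matters only for \<open>t = \<infinity>\<close>, where the set of all
  index tuples is infinite. By \<open>finite_ISS_support\<close> below, the sum is then a
  finite one for every time series that is eventually zero.
\<close>

definition ISS ::
    "enat \<Rightarrow> enat \<Rightarrow> (nat \<Rightarrow> 's::{comm_semiring_0, comm_monoid_mult} ^ 'd)
      \<Rightarrow> 'd letter list \<Rightarrow> 's" where
  "ISS s t z w =
     (\<Sum>js\<in>{js \<in> ISS_indices s t (length w). ISS_term z w js \<noteq> 0}. ISS_term z w js)"

lemma ISS_Nil: "ISS s t z [] = 1"
proof -
  have "{js \<in> ISS_indices s t 0. ISS_term z [] js \<noteq> 0} = (if (1::'a) = 0 then {} else {[]})"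
    by (auto simp: ISS_indices_def ISS_term_def)
  then show ?thesis
    by (auto simp: ISS_def ISS_term_def)
qed

lemma letter_power_zero:
  "letter_power (0 :: 's::{comm_semiring_0, comm_monoid_mult} ^ 'd) a = 0"
proof -
  have "mset_of_letter a \<noteq> {#}"
    using mset_of_letter[of a] by simp
  then obtain i M where "mset_of_letter a = add_mset i M"
    by (meson multiset_cases)
  then show ?thesis
    by (simp add: letter_power_def)
qed

lemma finite_ISS_support:
  fixes z :: "nat \<Rightarrow> 's::{comm_semiring_0, comm_monoid_mult} ^ 'd"
  assumes "eventually (\<lambda>j. z j = 0) sequentially"
  shows "finite {js \<in> ISS_indices s t (length w). ISS_term z w js \<noteq> 0}"
proof -
  obtain N where N: "\<And>j. j \<ge> N \<Longrightarrow> z j = 0"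
    using assms by (auto simp: eventually_sequentially)
  have zero: "prod f A = 0" if "finite A" "i \<in> A" "f i = 0" for f :: "nat \<Rightarrow> 's" and A i
    using that by (simp add: prod.remove[of A i])
  have "js \<in> {js. set js \<subseteq> {..<N} \<and> length js = length w}"
    if js: "js \<in> ISS_indices s t (length w)" and nz: "ISS_term z w js \<noteq> 0" for js
  proof -
    have len: "length js = length w"
      using js by (simp add: ISS_indices_def)
    have "js ! i < N" if "i < length w" for i
    proof (rule ccontr)
      assume "\<not> js ! i < N"
      then have "letter_power (z (js ! i)) (w ! i) = 0"
        using N by (simp add: letter_power_zero)
      with that have "ISS_term z w js = 0"
        unfolding ISS_term_def by (intro zero[of _ i]) auto
      with nz show False by simp
    qed
    with len show ?thesis
      by (auto simp: in_set_conv_nth)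
  qed
  then show ?thesis
    by (intro finite_subset[OF _ finite_lists_length_eq[of "{..<N}" "length w"]]) auto
qed

end

theory Submission imports Defs begin

text \<open>
  Let \<open>F n w\<close> be the sum defining \<open>\<langle>ISS, w\<rangle>\<close> restricted to index tuples below \<open>n\<close>. Splitting off
  the tuples whose last entry is \<open>n\<close> gives \<open>F (n + 1) (w a) = F n (w a) + F n w \<odot> x n a\<close>, where
  \<open>x n\<close> is multiplicative on letters. Multiplying this recursion for \<open>u a\<close> and \<open>v b\<close> produces
  exactly the three terms of the recursion of \<open>u a \<star> v b\<close>, so \<open>F n\<close> is multiplicative on words by
  induction on \<open>n\<close>. As \<open>z\<close> is eventually zero, \<open>F n\<close> is the full signature for large \<open>n\<close>.
\<close>

text \<open>Keys may disappear in a sum or under scaling, through cancellation or zero divisors.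
  Padding with zero coefficients lets all sums run over one index set.\<close>

lemma lin_ext_superset:
  assumes "finite A" "Poly_Mapping.keys p \<subseteq> A"
  shows "lin_ext F p = (\<Sum>w\<in>A. Poly_Mapping.lookup p w * F w)"
  unfolding lin_ext_def
  by (rule sum.mono_neutral_left) (use assms in \<open>auto simp: in_keys_iff\<close>)

lemma lin_ext_zero [simp]: "lin_ext F 0 = 0"
  by (simp add: lin_ext_def)

lemma lin_ext_zero_fun: "lin_ext (\<lambda>w. 0) p = 0"
  by (simp add: lin_ext_def)

lemma lin_ext_add: "lin_ext F (p + q) = lin_ext F p + lin_ext F q"
proof -
  let ?A = "Poly_Mapping.keys p \<union> Poly_Mapping.keys q"
  have "Poly_Mapping.keys (p + q) \<subseteq> ?A"
    by (rule Poly_Mapping.keys_add)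
  then show ?thesis
    by (simp add: lin_ext_superset[of ?A] lookup_add distrib_right sum.distrib)
qed

lemma lin_ext_sum: "lin_ext F (sum f A) = (\<Sum>i\<in>A. lin_ext F (f i))"
  by (induction A rule: infinite_finite_induct) (simp_all add: lin_ext_add)

lemma lin_ext_single [simp]: "lin_ext F (Poly_Mapping.single w c) = c * F w"
  by (simp add: lin_ext_superset[of "{w}"])

lemma lin_ext_scale: "lin_ext F (scale c p) = c * lin_ext F p"
proof -
  have lookup: "Poly_Mapping.lookup (scale c p) w = c * Poly_Mapping.lookup p w" for w
    by (simp add: scale_def map.rep_eq when_def)
  have "Poly_Mapping.keys (scale c p) \<subseteq> Poly_Mapping.keys p"
    by (auto simp: in_keys_iff lookup)
  then show ?thesis
    by (simp add: lin_ext_superset[of "Poly_Mapping.keys p"] lookup sum_distrib_left mult.assoc)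
qed

text \<open>Moving the appended letter from the argument into the functional makes recursions for
  \<open>F\<close> on \<open>w @ [a]\<close> applicable inside a quasi-shuffle.\<close>

lemma lin_ext_append_letter: "lin_ext F (append_letter p a) = lin_ext (\<lambda>w. F (w @ [a])) p"
  unfolding append_letter_def lin_ext_sum lin_ext_single by (simp add: lin_ext_def)

lemma lin_ext_add_fun: "lin_ext (\<lambda>w. F w + G w) p = lin_ext F p + lin_ext G p"
  by (simp add: lin_ext_def distrib_left sum.distrib)

lemma lin_ext_mult_right: "lin_ext (\<lambda>w. F w * c) p = lin_ext F p * c"
  by (simp add: lin_ext_def sum_distrib_right mult.assoc)

lemma lin_ext_quasi_shuffle:
  fixes F :: "'a::ab_semigroup_mult list \<Rightarrow> 's::{comm_semiring_0, comm_monoid_mult}"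
  assumes "\<And>u v. lin_ext F (quasi_shuffle_words u v) = F u * F v"
  shows "lin_ext F (p \<star> q) = lin_ext F p * lin_ext F q"
  unfolding quasi_shuffle_def lin_ext_sum lin_ext_scale assms
  by (simp add: lin_ext_def sum_product ac_simps)

lemma quasi_shuffle_words_Nil [simp]: "quasi_shuffle_words [] v = Poly_Mapping.single v 1"
  by (cases v rule: rev_cases) simp_all

text \<open>The inductive core, freed from index tuples: only the recursion in \<open>n\<close> and
  the multiplicativity of \<open>x n\<close> enter.\<close>

lemma lin_ext_quasi_shuffle_words:
  fixes F :: "nat \<Rightarrow> 'a::ab_semigroup_mult list \<Rightarrow> 's::{comm_semiring_0, comm_monoid_mult}"
    and x :: "nat \<Rightarrow> 'a \<Rightarrow> 's"
  assumes Nil: "\<And>n. F n [] = 1"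
    and zero: "\<And>w a. F 0 (w @ [a]) = 0"
    and Suc: "\<And>n w a. F (Suc n) (w @ [a]) = F n (w @ [a]) + F n w * x n a"
    and mult: "\<And>n a b. x n (a * b) = x n a * x n b"
  shows "lin_ext (F n) (quasi_shuffle_words u v) = F n u * F n v"
proof (induction n arbitrary: u v)
  case 0
  \<comment> \<open>\<open>F 0\<close> is the indicator of the empty word, and a product of two
    nonempty words contains only nonempty words.\<close>
  show ?case
    by (cases u rule: rev_cases; cases v rule: rev_cases)
      (simp_all add: Nil zero lin_ext_add lin_ext_append_letter lin_ext_zero_fun)
next
  case (Suc n)
  have append: "lin_ext (F (Suc n)) (append_letter p a)
      = lin_ext (F n) (append_letter p a) + lin_ext (F n) p * x n a" for p a
    by (simp add: lin_ext_append_letter assms(3) lin_ext_add_fun lin_ext_mult_right)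
  show ?case
  proof (cases "u = [] \<or> v = []")
    case True
    then show ?thesis
      by (auto simp: Nil)
  next
    case False
    then obtain u' a v' b where uv: "u = u' @ [a]" "v = v' @ [b]"
      by (metis rev_exhaust)
    \<comment> \<open>\<open>append\<close> splits each of the three terms of the product in two;
      the level-\<open>n\<close> parts reassemble into the product of \<open>u\<close> and
      \<open>v\<close>.\<close>
    have "lin_ext (F (Suc n)) (quasi_shuffle_words u v)
        = lin_ext (F n) (quasi_shuffle_words u v)
          + lin_ext (F n) (quasi_shuffle_words u' v) * x n a
          + lin_ext (F n) (quasi_shuffle_words u v') * x n b
          + lin_ext (F n) (quasi_shuffle_words u' v') * x n (a * b)"
      by (simp add: uv lin_ext_add append ac_simps)
    \<comment> \<open>The merged letter \<open>a * b\<close> accounts for both words using the index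
      \<open>n\<close>.\<close>
    also have "\<dots> = (F n u + F n u' * x n a) * (F n v + F n v' * x n b)"
      by (simp add: Suc.IH mult algebra_simps)
    finally show ?thesis
      by (simp add: uv assms(3))
  qed
qed

lemma letter_power_mult: "letter_power x (a * b) = letter_power x a * letter_power x b"
  by (simp add: letter_power_def times_letter.rep_eq)

text \<open>The bound \<open>n\<close> makes the index set finite even for
  \<open>t = \<infinity>\<close>, so the sum can include zero summands and be split by last
  entry.\<close>

definition ISS_below ::
    "enat \<Rightarrow> enat \<Rightarrow> (nat \<Rightarrow> 's::{comm_semiring_0, comm_monoid_mult} ^ 'd)
      \<Rightarrow> nat \<Rightarrow> 'd letter list \<Rightarrow> 's" where
  "ISS_below s t z n w =
     (\<Sum>js\<in>{js \<in> ISS_indices s t (length w). set js \<subseteq> {..<n}}. ISS_term z w js)"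

lemma finite_ISS_indices_below: "finite {js \<in> ISS_indices s t k. set js \<subseteq> {..<n}}"
  by (rule finite_subset[OF _ finite_lists_length_eq[of "{..<n}" k]])
    (auto simp: ISS_indices_def)

text \<open>Letters are non-constant monomials, so they vanish at the zero vector.\<close>

lemma ISS_term_eq_0:
  fixes z :: "nat \<Rightarrow> 's::{comm_semiring_0, comm_monoid_mult} ^ 'd"
  assumes "length js = length w" "j \<in> set js" "z j = 0"
  shows "ISS_term z w js = 0"
proof -
  obtain i where "i < length w" "z (js ! i) = 0"
    using assms by (auto simp: in_set_conv_nth)
  then show ?thesis
    by (simp add: ISS_term_def prod.remove[of "{..<length w}" i] letter_power_zero)
qed

text \<open>A nonzero summand has all indices below \<open>N\<close>, so the two sums differ only by
  zero summands.\<close>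

lemma ISS_eq_ISS_below:
  assumes "\<And>j. j \<ge> N \<Longrightarrow> z j = 0"
  shows "ISS s t z w = ISS_below s t z N w"
  unfolding ISS_def ISS_below_def
proof (rule sum.mono_neutral_left[OF finite_ISS_indices_below])
  have "j < N" if "js \<in> ISS_indices s t (length w)" "ISS_term z w js \<noteq> 0" "j \<in> set js" for js j
    using that assms[of j] ISS_term_eq_0[of js w j z]
    by (auto simp: ISS_indices_def not_less[symmetric])
  then show "{js \<in> ISS_indices s t (length w). ISS_term z w js \<noteq> 0}
      \<subseteq> {js \<in> ISS_indices s t (length w). set js \<subseteq> {..<N}}"
    by auto
qed auto

lemma ISS_term_append:
  assumes "length js = length w"
  shows "ISS_term z (w @ [a]) (js @ [n]) = ISS_term z w js * letter_power (z n) a"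
  using assms by (simp add: ISS_term_def nth_append lessThan_Suc mult.commute)

lemma ISS_below_Nil: "ISS_below s t z n [] = 1"
proof -
  have "{js \<in> ISS_indices s t 0. set js \<subseteq> {..<n}} = {[]}"
    by (auto simp: ISS_indices_def)
  then show ?thesis
    by (simp add: ISS_below_def ISS_term_def)
qed

lemma ISS_below_0: "ISS_below s t z 0 (w @ [a]) = 0"
proof -
  have "{js \<in> ISS_indices s t (length (w @ [a])). set js \<subseteq> {..<0}} = {}"
    by (auto simp: ISS_indices_def)
  then show ?thesis
    by (simp only: ISS_below_def sum.empty)
qed

text \<open>In an increasing tuple with entries at most \<open>n\<close>, only the last entry can
  equal \<open>n\<close>.\<close>

lemma ISS_indices_below_Suc:
  "{js \<in> ISS_indices s t (Suc k). set js \<subseteq> {..<Suc n}}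
   = {js \<in> ISS_indices s t (Suc k). set js \<subseteq> {..<n}}
     \<union> (if s < enat n \<and> enat n < t + 1
        then (\<lambda>js. js @ [n]) ` {js \<in> ISS_indices s t k. set js \<subseteq> {..<n}} else {})"
    (is "?L = ?R")
proof (intro equalityI subsetI)
  fix js assume js: "js \<in> ?L"
  then obtain js' j where eq: "js = js' @ [j]"
    by (cases js rule: rev_cases) (auto simp: ISS_indices_def)
  show "js \<in> ?R"
  proof (cases "j = n")
    case True
    then show ?thesis
      using js eq by (auto simp: ISS_indices_def sorted_wrt_append)
  next
    case False
    then have "j < n"
      using js eq by auto
    moreover have "i < j" if "i \<in> set js'" for i
      using js eq that by (simp add: ISS_indices_def sorted_wrt_append)
    ultimately have "set js \<subseteq> {..<n}"
      using eq by fastforce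
    then show ?thesis
      using js by simp
  qed
next
  fix js assume "js \<in> ?R"
  then show "js \<in> ?L"
    by (auto simp: ISS_indices_def sorted_wrt_append less_Suc_eq split: if_splits)
qed

text \<open>The two families of tuples are disjoint, as only the second contains \<open>n\<close>.
  For \<open>n\<close> outside the window the second is empty, matching the weight
  \<open>0\<close>.\<close>

lemma ISS_below_Suc:
  "ISS_below s t z (Suc n) (w @ [a]) = ISS_below s t z n (w @ [a])
     + ISS_below s t z n w * (if s < enat n \<and> enat n < t + 1 then letter_power (z n) a else 0)"
proof (cases "s < enat n \<and> enat n < t + 1")
  case True
  let ?I = "\<lambda>k. {js \<in> ISS_indices s t k. set js \<subseteq> {..<n}}"
  have "ISS_below s t z (Suc n) (w @ [a])
      = (\<Sum>js\<in>?I (Suc (length w)) \<union> (\<lambda>js. js @ [n]) ` ?I (length w). ISS_term z (w @ [a]) js)"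
    using True by (simp add: ISS_below_def ISS_indices_below_Suc)
  also have "\<dots> = ISS_below s t z n (w @ [a])
      + (\<Sum>js\<in>(\<lambda>js. js @ [n]) ` ?I (length w). ISS_term z (w @ [a]) js)"
    by (subst sum.union_disjoint) (auto simp: finite_ISS_indices_below ISS_below_def)
  also have "(\<Sum>js\<in>(\<lambda>js. js @ [n]) ` ?I (length w). ISS_term z (w @ [a]) js)
      = (\<Sum>js\<in>?I (length w). ISS_term z (w @ [a]) (js @ [n]))"
    by (subst sum.reindex) (auto simp: inj_on_def)
  also have "\<dots> = ISS_below s t z n w * letter_power (z n) a"
    unfolding ISS_below_def sum_distrib_right
    by (rule sum.cong) (auto simp: ISS_indices_def ISS_term_append)
  finally show ?thesis
    using True by simp
next
  case False
  then show ?thesis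
    by (simp add: ISS_below_def ISS_indices_below_Suc del: de_Morgan_conj)
qed

theorem lemma2p13:
  fixes z :: "nat \<Rightarrow> 's::{comm_semiring_0, comm_monoid_mult} ^ 'd::finite"
    and s t :: enat
    and w v :: "'d letter list \<Rightarrow>\<^sub>0 's"
  assumes "\<forall>\<^sub>F j in sequentially. z j = 0"
    and "s \<le> t"
  shows "lin_ext (ISS s t z) w * lin_ext (ISS s t z) v = lin_ext (ISS s t z) (w \<star> v)"
proof -
  obtain N where "\<And>j. j \<ge> N \<Longrightarrow> z j = 0"
    using assms(1) by (auto simp: eventually_sequentially)
  then have "ISS s t z = ISS_below s t z N"
    by (intro ext ISS_eq_ISS_below)
  moreover have "lin_ext (ISS_below s t z N) (quasi_shuffle_words a b)
      = ISS_below s t z N a * ISS_below s t z N b" for a b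
    \<comment> \<open>Setting the weight to \<open>0\<close> outside the window keeps it
      multiplicative, since \<open>0 * 0 = 0\<close>.\<close>
    by (rule lin_ext_quasi_shuffle_words[where
          x = "\<lambda>n a. if s < enat n \<and> enat n < t + 1 then letter_power (z n) a else 0"])
      (simp_all add: ISS_below_Nil ISS_below_0 ISS_below_Suc letter_power_mult)
  ultimately show ?thesis
    by (simp add: lin_ext_quasi_shuffle)
qed

end
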